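(* Let $\mathfrak{A}$ be a residuated lattice. The following assertions are equivalent: (1) the bounded distributive lattice $\mathscr{F}(\mathfrak{A})$ of all filters of $\mathfrak{A}$ is normal; (2) the bounded distributive lattice $\mathscr{PF}(\mathfrak{A})$ of all principal filters of $\mathfrak{A}$ is normal; (3) $\mathfrak{A}$ is Gelfand.
   Context: A residuated lattice is an algebra $\mathfrak{A}=(A;\vee,\wedge,\odot,\rightarrow,0,1)$ such that $(A;\vee,\wedge,0,1)$ is a bounded lattice, $(A;\odot,1)$ is a commutative monoid, and $x\odot y\le z$ iff $x\le y\rightarrow z$ for all $x,y,z\in A$. A filter of $\mathfrak{A}$ is a non-empty subset $F\subseteq A$ such that $x,y\in F$ implies $x\odot y\in F$, and $x\in F$, $y\in A$ imply $x\vee y\in F$. A filter is proper if it is not $A$; a maximal filter is a maximal element (under inclusion) among proper filters; a prime filter is a proper filter $\mathfrak{p}$ such that $x\vee y\in\mathfrak{p}$ implies $x\in\mathfrak{p}$ or $y\in\mathfrak{p}$. $\mathfrak{A}$ is Gelfand if every prime filter is contained in a unique maximal filter. The set $\mathscr{F}(\mathfrak{A})$ of filters, ordered by inclusion, is a bounded distributive lattice with meet $\cap$, join $F\veebar G$ = filter generated by $F\cup G$, bottom $\{1\}$ and top $A$. For $x\in A$, $\mathscr{F}(x)$ is the filter generated by $\{x\}$; such filters are called principal, and the set $\mathscr{PF}(\mathfrak{A})$ of principal filters is a sublattice of $\mathscr{F}(\mathfrak{A})$ (containing $\{1\}=\mathscr{F}(1)$ and $A=\mathscr{F}(0)$). A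 bounded distributive lattice $L$ is normal if for all $x,y\in L$ with $x\vee y=1$ there exist $u,v\in L$ such that $u\vee x=v\vee y=1$ and $u\wedge v=0$. *)

theory Defs
  imports "HOL-Algebra.Group" "HOL.Hull"
begin

section \<open>Bounded distributive lattices and normality\<close>

locale bounded_distributive_lattice = bounded_lattice +
  assumes meet_join_distrib:
    "\<lbrakk>x \<in> carrier L; y \<in> carrier L; z \<in> carrier L\<rbrakk>
      \<Longrightarrow> x \<sqinter> (y \<squnion> z) = (x \<sqinter> y) \<squnion> (x \<sqinter> z)"

locale normal_lattice = bounded_distributive_lattice +
  assumes normality:
    "\<lbrakk>x \<in> carrier L; y \<in> carrier L; x \<squnion> y = \<top>\<rbrakk>
      \<Longrightarrow> \<exists>u \<in> carrier L. \<exists>v \<in> carrier L. u \<squnion> x = \<top> \<and> v \<squnion> y = \<top> \<and> u \<sqinter> v = \<bottom>"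


section \<open>Residuated lattices\<close>

text \<open>
  The lattice operations and the constants 0 and 1 are those induced by the order:
  \<open>\<squnion>\<close>, \<open>\<sqinter>\<close>, \<open>\<bottom>\<close> and \<open>\<top>\<close>. In particular the unit of the monoid is \<open>\<top>\<close>. The trivial algebra,
  with \<open>\<bottom> = \<top>\<close>, is not excluded.
\<close>

record 'a reslat = "'a gorder" +
  rmult :: "['a, 'a] \<Rightarrow> 'a" (infixl \<open>\<odot>\<index>\<close> 70)
  residuum :: "['a, 'a] \<Rightarrow> 'a" (infixr \<open>\<leadsto>\<index>\<close> 60)

locale residuated_lattice = bounded_lattice A for A (structure) +
  assumes comm_monoid_rmult:
      "comm_monoid \<lparr>carrier = carrier A, monoid.mult = (\<odot>), one = \<top>\<rparr>"
    and residuum_closed: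
      "\<lbrakk>x \<in> carrier A; y \<in> carrier A\<rbrakk> \<Longrightarrow> x \<leadsto> y \<in> carrier A"
    and residuation:
      "\<lbrakk>x \<in> carrier A; y \<in> carrier A; z \<in> carrier A\<rbrakk> \<Longrightarrow> x \<odot> y \<sqsubseteq> z \<longleftrightarrow> x \<sqsubseteq> y \<leadsto> z"


section \<open>Filters\<close>

definition rl_filter :: "('a, 'b) reslat_scheme \<Rightarrow> 'a set \<Rightarrow> bool" where
  "rl_filter A F \<longleftrightarrow> F \<subseteq> carrier A \<and> F \<noteq> {} \<and>
    (\<forall>x \<in> F. \<forall>y \<in> F. x \<odot>\<^bsub>A\<^esub> y \<in> F) \<and> (\<forall>x \<in> F. \<forall>y \<in> carrier A. x \<squnion>\<^bsub>A\<^esub> y \<in> F)"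

definition proper_filter :: "('a, 'b) reslat_scheme \<Rightarrow> 'a set \<Rightarrow> bool" where
  "proper_filter A F \<longleftrightarrow> rl_filter A F \<and> F \<noteq> carrier A"

definition maximal_filter :: "('a, 'b) reslat_scheme \<Rightarrow> 'a set \<Rightarrow> bool" where
  "maximal_filter A M \<longleftrightarrow> proper_filter A M \<and> (\<forall>F. proper_filter A F \<longrightarrow> M \<subseteq> F \<longrightarrow> F = M)"

definition prime_filter :: "('a, 'b) reslat_scheme \<Rightarrow> 'a set \<Rightarrow> bool" where
  "prime_filter A P \<longleftrightarrow> proper_filter A P \<and>
    (\<forall>x \<in> carrier A. \<forall>y \<in> carrier A. x \<squnion>\<^bsub>A\<^esub> y \<in> P \<longrightarrow> x \<in> P \<or> y \<in> P)"

definition gelfand :: "('a, 'b) reslat_scheme \<Rightarrow> bool" where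
  "gelfand A \<longleftrightarrow> (\<forall>P. prime_filter A P \<longrightarrow> (\<exists>!M. maximal_filter A M \<and> P \<subseteq> M))"

definition generated_filter :: "('a, 'b) reslat_scheme \<Rightarrow> 'a set \<Rightarrow> 'a set" where
  "generated_filter A X = rl_filter A hull X"

text \<open>
  The lattices of filters are given by their carriers and the inclusion order. That the operations
  induced by the order are intersection and the filter generated by the union, and that the
  principal filters form a sublattice of the lattice of all filters, is proved at the end.
\<close>

definition filter_lattice :: "('a, 'b) reslat_scheme \<Rightarrow> 'a set gorder" where
  "filter_lattice A = \<lparr>carrier = {F. rl_filter A F}, eq = (=), le = (\<subseteq>)\<rparr>"

definition principal_filter_lattice :: "('a, 'b) reslat_scheme \<Rightarrow> 'a set gorder" where
  "principal_filter_lattice A =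
    \<lparr>carrier = {generated_filter A {x} | x. x \<in> carrier A}, eq = (=), le = (\<subseteq>)\<rparr>"


section \<open>The lattices of filters are bounded and distributive\<close>

context residuated_lattice
begin

lemma rmult_closed: "\<lbrakk>x \<in> carrier A; y \<in> carrier A\<rbrakk> \<Longrightarrow> x \<odot> y \<in> carrier A"
  using monoid.m_closed[OF comm_monoid.axioms(1)[OF comm_monoid_rmult]] by simp

lemma rmult_comm: "\<lbrakk>x \<in> carrier A; y \<in> carrier A\<rbrakk> \<Longrightarrow> x \<odot> y = y \<odot> x"
  using comm_monoid.m_comm[OF comm_monoid_rmult, of x y] by simp

lemma rmult_assoc:
  "\<lbrakk>x \<in> carrier A; y \<in> carrier A; z \<in> carrier A\<rbrakk> \<Longrightarrow> (x \<odot> y) \<odot> z = x \<odot> (y \<odot> z)"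
  using monoid.m_assoc[OF comm_monoid.axioms(1)[OF comm_monoid_rmult]] by simp

lemma rmult_top: "x \<in> carrier A \<Longrightarrow> x \<odot> \<top> = x"
  using monoid.r_one[OF comm_monoid.axioms(1)[OF comm_monoid_rmult]] by simp

lemma rmult_mono_left:
  assumes "x \<sqsubseteq> y" "x \<in> carrier A" "y \<in> carrier A" "z \<in> carrier A"
  shows "x \<odot> z \<sqsubseteq> y \<odot> z"
proof -
  have "y \<sqsubseteq> z \<leadsto> (y \<odot> z)"
    using assms residuation[of y z "y \<odot> z"] rmult_closed by simp
  then have "x \<sqsubseteq> z \<leadsto> (y \<odot> z)"
    using assms le_trans[OF assms(1)] residuum_closed rmult_closed by simp
  then show ?thesis
    using assms residuation rmult_closed by simp
qed

lemma rmult_mono: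
  assumes "x \<sqsubseteq> y" "z \<sqsubseteq> w" "x \<in> carrier A" "y \<in> carrier A" "z \<in> carrier A" "w \<in> carrier A"
  shows "x \<odot> z \<sqsubseteq> y \<odot> w"
proof -
  have "x \<odot> z \<sqsubseteq> y \<odot> z" using assms rmult_mono_left by simp
  moreover have "y \<odot> z \<sqsubseteq> y \<odot> w"
    using assms rmult_mono_left[of z w y] rmult_comm[of y z] rmult_comm[of y w] by simp
  ultimately show ?thesis
    using assms le_trans[of "x \<odot> z" "y \<odot> z" "y \<odot> w"] rmult_closed by simp
qed

lemma rmult_le_left: "\<lbrakk>x \<in> carrier A; y \<in> carrier A\<rbrakk> \<Longrightarrow> x \<odot> y \<sqsubseteq> x"
  using rmult_mono[of x x y \<top>] rmult_top by simp

lemma rmult_le_right: "\<lbrakk>x \<in> carrier A; y \<in> carrier A\<rbrakk> \<Longrightarrow> x \<odot> y \<sqsubseteq> y"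
  using rmult_le_left rmult_comm by metis

lemma rmult_join_le:
  assumes "x \<in> carrier A" "y \<in> carrier A" "z \<in> carrier A" "w \<in> carrier A"
    "x \<odot> z \<sqsubseteq> w" "y \<odot> z \<sqsubseteq> w"
  shows "(x \<squnion> y) \<odot> z \<sqsubseteq> w"
  using assms residuation residuum_closed join_le by simp

lemma join_rmult_join_le:
  assumes "a \<in> carrier A" "b \<in> carrier A" "y \<in> carrier A"
  shows "(a \<squnion> y) \<odot> (b \<squnion> y) \<sqsubseteq> (a \<odot> b) \<squnion> y"
proof -
  let ?w = "(a \<odot> b) \<squnion> y"
  note c = assms rmult_closed
  have w: "?w \<in> carrier A" using c by simp
  have y: "u \<sqsubseteq> ?w" if "u \<sqsubseteq> y" "u \<in> carrier A" for u
    using that c le_trans[OF that(1) join_right[of "a \<odot> b" y]] by simp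
  have "a \<odot> b \<sqsubseteq> ?w" using c join_left by simp
  then have "b \<odot> a \<sqsubseteq> ?w"
    using rmult_comm[of b a] assms by simp
  moreover have "y \<odot> a \<sqsubseteq> ?w" "b \<odot> y \<sqsubseteq> ?w" "y \<odot> y \<sqsubseteq> ?w"
    using assms y rmult_le_left[of y a] rmult_le_right[of b y] rmult_le_left[of y y]
      rmult_closed by simp_all
  ultimately have "(b \<squnion> y) \<odot> a \<sqsubseteq> ?w" "(b \<squnion> y) \<odot> y \<sqsubseteq> ?w"
    using rmult_join_le[of b y a ?w] rmult_join_le[of b y y ?w] assms w by simp_all
  then have "a \<odot> (b \<squnion> y) \<sqsubseteq> ?w" "y \<odot> (b \<squnion> y) \<sqsubseteq> ?w"
    using rmult_comm[of a "b \<squnion> y"] rmult_comm[of y "b \<squnion> y"] assms by simp_all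
  then show ?thesis
    using rmult_join_le[of a y "b \<squnion> y" ?w] assms w by simp
qed

lemma filter_carrier: "rl_filter A F \<Longrightarrow> x \<in> F \<Longrightarrow> x \<in> carrier A"
  unfolding rl_filter_def by blast

lemma filter_rmult: "rl_filter A F \<Longrightarrow> x \<in> F \<Longrightarrow> y \<in> F \<Longrightarrow> x \<odot> y \<in> F"
  unfolding rl_filter_def by blast

lemma filter_join: "rl_filter A F \<Longrightarrow> x \<in> F \<Longrightarrow> y \<in> carrier A \<Longrightarrow> x \<squnion> y \<in> F"
  unfolding rl_filter_def by blast

lemma filter_up: "rl_filter A F \<Longrightarrow> x \<in> F \<Longrightarrow> x \<sqsubseteq> y \<Longrightarrow> y \<in> carrier A \<Longrightarrow> y \<in> F"
  by (metis filter_carrier filter_join le_iff_meet)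

lemma filter_top: "rl_filter A F \<Longrightarrow> \<top> \<in> F"
  by (metis equals0I filter_carrier filter_up rl_filter_def top_closed top_higher)

lemma filterI:
  assumes "F \<subseteq> carrier A" "\<top> \<in> F" "\<And>x y. x \<in> F \<Longrightarrow> y \<in> F \<Longrightarrow> x \<odot> y \<in> F"
    "\<And>x y. x \<in> F \<Longrightarrow> x \<sqsubseteq> y \<Longrightarrow> y \<in> carrier A \<Longrightarrow> y \<in> F"
  shows "rl_filter A F"
  unfolding rl_filter_def using assms join_left join_closed by (auto simp: subset_iff)

lemma filter_carrier_set: "rl_filter A (carrier A)"
  by (rule filterI) (auto simp: rmult_closed)

lemma filter_top_set: "rl_filter A {\<top>}"
proof (rule filterI)
  show "y \<in> {\<top>}" if "x \<in> {\<top>}" "x \<sqsubseteq> y" "y \<in> carrier A" for x y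
    using that by (auto intro: le_antisym)
qed (auto simp: rmult_top)

lemma filter_Int: "rl_filter A F \<Longrightarrow> rl_filter A G \<Longrightarrow> rl_filter A (F \<inter> G)"
  by (rule filterI) (auto intro: filter_top filter_rmult filter_up filter_carrier)

lemma filter_generated: "X \<subseteq> carrier A \<Longrightarrow> rl_filter A (generated_filter A X)"
  unfolding generated_filter_def hull_def using filter_carrier_set
  by (intro filterI) (auto intro: filter_top filter_rmult filter_up)

lemma generated_superset: "X \<subseteq> generated_filter A X"
  unfolding generated_filter_def by (rule hull_subset)

lemma generated_minimal: "X \<subseteq> F \<Longrightarrow> rl_filter A F \<Longrightarrow> generated_filter A X \<subseteq> F"
  unfolding generated_filter_def by (rule hull_minimal)

lemma generated_Un:
  assumes F: "rl_filter A F" and G: "rl_filter A G"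
  shows "generated_filter A (F \<union> G) = {z \<in> carrier A. \<exists>f \<in> F. \<exists>g \<in> G. f \<odot> g \<sqsubseteq> z}"
    (is "?L = ?R")
proof
  note cF = filter_carrier[OF F] and cG = filter_carrier[OF G]
  have "rl_filter A ?R"
  proof (rule filterI)
    show "\<top> \<in> ?R"
      using filter_top[OF F] filter_top[OF G] rmult_closed by fastforce
  next
    fix x y assume "x \<in> ?R" "y \<in> ?R"
    then obtain f g f' g' where *: "f \<in> F" "g \<in> G" "f' \<in> F" "g' \<in> G"
      "f \<odot> g \<sqsubseteq> x" "f' \<odot> g' \<sqsubseteq> y" "x \<in> carrier A" "y \<in> carrier A" by blast
    note c = cF[OF *(1)] cG[OF *(2)] cF[OF *(3)] cG[OF *(4)]
    have "(f \<odot> f') \<odot> (g \<odot> g') = (f \<odot> g) \<odot> (f' \<odot> g')"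
      using c by (metis rmult_assoc rmult_comm rmult_closed)
    also have "\<dots> \<sqsubseteq> x \<odot> y"
      using * c rmult_mono rmult_closed by simp
    finally show "x \<odot> y \<in> ?R"
      using * filter_rmult[OF F] filter_rmult[OF G] rmult_closed by blast
  next
    fix x y assume "x \<in> ?R" and y: "x \<sqsubseteq> y" "y \<in> carrier A"
    then obtain f g where *: "f \<in> F" "g \<in> G" "f \<odot> g \<sqsubseteq> x" "x \<in> carrier A" by blast
    then have "f \<odot> g \<sqsubseteq> y"
      using le_trans[OF *(3) y(1)] y cF cG rmult_closed by simp
    then show "y \<in> ?R" using * y by blast
  qed auto
  moreover have "f \<in> ?R" if "f \<in> F" for f
    using that cF[OF that] filter_top[OF G] rmult_le_left[of f \<top>] by auto
  moreover have "g \<in> ?R" if "g \<in> G" for g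
    using that cG[OF that] filter_top[OF F] rmult_le_right[of \<top> g] by auto
  ultimately show "?L \<subseteq> ?R"
    by (intro generated_minimal) auto
  have L: "rl_filter A ?L"
    using cF cG by (intro filter_generated) blast
  show "?R \<subseteq> ?L"
    using generated_superset[of "F \<union> G"] filter_rmult[OF L] filter_up[OF L] by blast
qed

lemma filter_distrib:
  assumes F: "rl_filter A F" and G: "rl_filter A G" and H: "rl_filter A H"
  shows "F \<inter> generated_filter A (G \<union> H) = generated_filter A ((F \<inter> G) \<union> (F \<inter> H))"
    (is "?L = ?R")
proof
  show "?R \<subseteq> ?L"
    using generated_superset[of "G \<union> H"] filter_generated[of "G \<union> H"]
      filter_carrier[OF G] filter_carrier[OF H] F
    by (intro generated_minimal filter_Int) blast+
  show "?L \<subseteq> ?R"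
  proof
    fix x assume "x \<in> ?L"
    then obtain g h where *: "x \<in> F" "g \<in> G" "h \<in> H" "g \<odot> h \<sqsubseteq> x" "x \<in> carrier A"
      using generated_Un[OF G H] by auto
    note c = filter_carrier[OF G *(2)] filter_carrier[OF H *(3)] *(5)
    have "(g \<squnion> x) \<odot> (h \<squnion> x) \<sqsubseteq> (g \<odot> h) \<squnion> x"
      using c join_rmult_join_le by simp
    moreover have "(g \<odot> h) \<squnion> x = x"
      using c * rmult_closed le_iff_meet by simp
    moreover have "g \<squnion> x \<in> F \<inter> G"
      using * c filter_join[OF G, of g x] filter_join[OF F, of x g] join_comm[of A g x] by simp
    moreover have "h \<squnion> x \<in> F \<inter> H"
      using * c filter_join[OF H, of h x] filter_join[OF F, of x h] join_comm[of A h x] by simp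
    ultimately show "x \<in> ?R"
      using generated_Un[OF filter_Int[OF F G] filter_Int[OF F H]] c by auto
  qed
qed

lemma filter_family_lattice:
  fixes S :: "'a set set"
  defines "L \<equiv> \<lparr>carrier = S, eq = (=), le = (\<subseteq>)\<rparr>"
  assumes S: "\<And>F. F \<in> S \<Longrightarrow> rl_filter A F" "{\<top>} \<in> S" "carrier A \<in> S"
    and Int: "\<And>F G. F \<in> S \<Longrightarrow> G \<in> S \<Longrightarrow> F \<inter> G \<in> S"
    and Un: "\<And>F G. F \<in> S \<Longrightarrow> G \<in> S \<Longrightarrow> generated_filter A (F \<union> G) \<in> S"
  shows "bounded_distributive_lattice L"
    and "\<And>F G. F \<in> S \<Longrightarrow> G \<in> S \<Longrightarrow> F \<squnion>\<^bsub>L\<^esub> G = generated_filter A (F \<union> G)"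
    and "\<And>F G. F \<in> S \<Longrightarrow> G \<in> S \<Longrightarrow> F \<sqinter>\<^bsub>L\<^esub> G = F \<inter> G"
    and "\<bottom>\<^bsub>L\<^esub> = {\<top>}"
    and "\<top>\<^bsub>L\<^esub> = carrier A"
proof -
  have sup: "least L (generated_filter A (F \<union> G)) (Upper L {F, G})" if "F \<in> S" "G \<in> S" for F G
    using that Un S generated_superset[of "F \<union> G"] generated_minimal[of "F \<union> G"]
    unfolding least_def Upper_def L_def by auto
  have inf: "greatest L (F \<inter> G) (Lower L {F, G})" if "F \<in> S" "G \<in> S" for F G
    using that Int unfolding greatest_def Lower_def L_def by auto
  have bot: "least L {\<top>} (carrier L)"
    using S filter_top unfolding least_def L_def by auto
  have top: "greatest L (carrier A) (carrier L)"
    using S unfolding greatest_def L_def rl_filter_def by auto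
  have carr: "carrier L = S" by (simp add: L_def)
  interpret L: bounded_lattice L
  proof unfold_locales
    show "\<exists>s. least L s (Upper L {x, y})" if "x \<in> carrier L" "y \<in> carrier L" for x y
      using sup that carr by auto
    show "\<exists>s. greatest L s (Lower L {x, y})" if "x \<in> carrier L" "y \<in> carrier L" for x y
      using inf that carr by auto
    show "\<exists>x. least L x (carrier L)" "\<exists>x. greatest L x (carrier L)"
      using bot top by auto
  qed (auto simp: L_def)
  show join: "F \<squnion>\<^bsub>L\<^esub> G = generated_filter A (F \<union> G)" if "F \<in> S" "G \<in> S" for F G
    using L.joinI[of F G "\<lambda>l. l = generated_filter A (F \<union> G)"]
      L.least_unique[OF _ sup[OF that]] that carr by blast
  show meet: "F \<sqinter>\<^bsub>L\<^esub> G = F \<inter> G" if "F \<in> S" "G \<in> S" for F G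
    using L.meetI[of F G "\<lambda>l. l = F \<inter> G"] L.greatest_unique[OF _ inf[OF that]] that carr by blast
  show "\<bottom>\<^bsub>L\<^esub> = {\<top>}" using L.least_unique L.bottom_least bot by blast
  show "\<top>\<^bsub>L\<^esub> = carrier A" using L.greatest_unique L.top_greatest top by blast
  show "bounded_distributive_lattice L"
    by unfold_locales (auto simp: carr join meet Int Un filter_distrib S)
qed

theorem filter_lattice:
  shows "bounded_distributive_lattice (filter_lattice A)"
    and "\<And>F G. rl_filter A F \<Longrightarrow> rl_filter A G
      \<Longrightarrow> F \<squnion>\<^bsub>filter_lattice A\<^esub> G = generated_filter A (F \<union> G)"
    and "\<And>F G. rl_filter A F \<Longrightarrow> rl_filter A G \<Longrightarrow> F \<sqinter>\<^bsub>filter_lattice A\<^esub> G = F \<inter> G"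
    and "\<bottom>\<^bsub>filter_lattice A\<^esub> = {\<top>}"
    and "\<top>\<^bsub>filter_lattice A\<^esub> = carrier A"
proof -
  let ?S = "{F. rl_filter A F}"
  have *: "rl_filter A F" if "F \<in> ?S" for F using that by simp
  have top_carrier: "{\<top>} \<in> ?S" "carrier A \<in> ?S"
    using filter_top_set filter_carrier_set by simp_all
  have Int_Un: "F \<inter> G \<in> ?S" "generated_filter A (F \<union> G) \<in> ?S" if "F \<in> ?S" "G \<in> ?S" for F G
    using that filter_Int[of F G] filter_generated[of "F \<union> G"] by (auto simp: rl_filter_def)
  note family = filter_family_lattice[of ?S, OF * top_carrier Int_Un, folded filter_lattice_def]
  show "bounded_distributive_lattice (filter_lattice A)" by (rule family(1))
  show "F \<squnion>\<^bsub>filter_lattice A\<^esub> G = generated_filter A (F \<union> G)"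
    if "rl_filter A F" "rl_filter A G" for F G using family(2) that by simp
  show "F \<sqinter>\<^bsub>filter_lattice A\<^esub> G = F \<inter> G"
    if "rl_filter A F" "rl_filter A G" for F G using family(3) that by simp
  show "\<bottom>\<^bsub>filter_lattice A\<^esub> = {\<top>}" by (rule family(4))
  show "\<top>\<^bsub>filter_lattice A\<^esub> = carrier A" by (rule family(5))
qed

lemma filter_join_right:
  assumes F: "rl_filter A F" and y: "y \<in> carrier A"
  shows "rl_filter A {a \<in> carrier A. a \<squnion> y \<in> F}"
proof (rule filterI)
  show "\<top> \<in> {a \<in> carrier A. a \<squnion> y \<in> F}"
    using filter_join[OF F filter_top[OF F] y] by simp
next
  fix a b assume "a \<in> {a \<in> carrier A. a \<squnion> y \<in> F}" "b \<in> {a \<in> carrier A. a \<squnion> y \<in> F}"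
  then have ab: "a \<in> carrier A" "b \<in> carrier A" "(a \<squnion> y) \<odot> (b \<squnion> y) \<in> F"
    using filter_rmult[OF F] by auto
  have "(a \<odot> b) \<squnion> y \<in> F"
    using filter_up[OF F ab(3) join_rmult_join_le] ab y rmult_closed by simp
  then show "a \<odot> b \<in> {a \<in> carrier A. a \<squnion> y \<in> F}"
    using ab rmult_closed by simp
next
  fix a b assume "a \<in> {a \<in> carrier A. a \<squnion> y \<in> F}" and b: "a \<sqsubseteq> b" "b \<in> carrier A"
  then have a: "a \<in> carrier A" "a \<squnion> y \<in> F" by auto
  have "a \<sqsubseteq> b \<squnion> y"
    using le_trans[OF b(1) join_left[OF b(2) y]] a b y by simp
  then have "a \<squnion> y \<sqsubseteq> b \<squnion> y"
    using a b y join_right by (intro join_le) simp_all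
  then show "b \<in> {a \<in> carrier A. a \<squnion> y \<in> F}"
    using filter_up[OF F a(2)] b y by simp
qed blast

lemma principal_Int:
  assumes x: "x \<in> carrier A" and y: "y \<in> carrier A"
  shows "generated_filter A {x} \<inter> generated_filter A {y} = generated_filter A {x \<squnion> y}"
proof
  let ?G = "generated_filter A {x \<squnion> y}"
  have G: "rl_filter A ?G" "x \<squnion> y \<in> ?G"
    using x y filter_generated[of "{x \<squnion> y}"] generated_superset[of "{x \<squnion> y}"] by auto
  show "generated_filter A {x} \<inter> generated_filter A {y} \<subseteq> ?G"
  proof
    fix z assume z: "z \<in> generated_filter A {x} \<inter> generated_filter A {y}"
    then have zA: "z \<in> carrier A"
      using filter_carrier[OF filter_generated, of "{x}"] x by auto
    have "generated_filter A {x} \<subseteq> {a \<in> carrier A. a \<squnion> y \<in> ?G}"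
      using G x y by (intro generated_minimal filter_join_right) auto
    then have "y \<squnion> z \<in> ?G" using z join_comm[of A y z] by auto
    then have "generated_filter A {y} \<subseteq> {a \<in> carrier A. a \<squnion> z \<in> ?G}"
      using G zA y by (intro generated_minimal filter_join_right) auto
    then have "z \<squnion> z \<in> ?G" using z by auto
    moreover have "z \<squnion> z = z"
      using le_iff_meet[OF zA zA] zA by simp
    ultimately show "z \<in> ?G" by simp
  qed
  have "x \<squnion> y \<in> generated_filter A {x}"
    using filter_join[OF filter_generated, of "{x}" x y] generated_superset[of "{x}"] x y by auto
  moreover have "y \<squnion> x \<in> generated_filter A {y}"
    using filter_join[OF filter_generated, of "{y}" y x] generated_superset[of "{y}"] x y by auto
  then have "x \<squnion> y \<in> generated_filter A {y}"
    using join_comm[of A x y] by simp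
  ultimately show "?G \<subseteq> generated_filter A {x} \<inter> generated_filter A {y}"
    using x y by (intro generated_minimal filter_Int filter_generated) auto
qed

lemma principal_Un:
  assumes x: "x \<in> carrier A" and y: "y \<in> carrier A"
  shows "generated_filter A (generated_filter A {x} \<union> generated_filter A {y})
    = generated_filter A {x \<odot> y}"
proof
  have xy: "x \<odot> y \<in> carrier A" using x y rmult_closed by simp
  let ?G = "generated_filter A {x \<odot> y}"
  let ?U = "generated_filter A {x} \<union> generated_filter A {y}"
  have G: "rl_filter A ?G" "x \<odot> y \<in> ?G"
    using xy filter_generated[of "{x \<odot> y}"] generated_superset[of "{x \<odot> y}"] by auto
  have "x \<in> ?G" "y \<in> ?G"
    using filter_up[OF G] x y rmult_le_left[of x y] rmult_le_right[of x y] by auto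
  then show "generated_filter A ?U \<subseteq> ?G"
    using G by (intro generated_minimal Un_least) auto
  have "?U \<subseteq> carrier A"
    using filter_generated[of "{x}"] filter_generated[of "{y}"] x y by (auto simp: rl_filter_def)
  then have U: "rl_filter A (generated_filter A ?U)" by (rule filter_generated)
  have "x \<in> generated_filter A ?U" "y \<in> generated_filter A ?U"
    using generated_superset[of ?U] generated_superset[of "{x}"] generated_superset[of "{y}"]
    by auto
  then show "?G \<subseteq> generated_filter A ?U"
    using U filter_rmult[OF U] by (intro generated_minimal) auto
qed

theorem principal_filter_lattice:
  defines "S \<equiv> {generated_filter A {x} | x. x \<in> carrier A}"
  shows "bounded_distributive_lattice (principal_filter_lattice A)"
    and "S \<subseteq> {F. rl_filter A F}"
    and "\<And>F G. F \<in> S \<Longrightarrow> G \<in> S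
      \<Longrightarrow> F \<squnion>\<^bsub>principal_filter_lattice A\<^esub> G = generated_filter A (F \<union> G)"
    and "\<And>F G. F \<in> S \<Longrightarrow> G \<in> S \<Longrightarrow> F \<sqinter>\<^bsub>principal_filter_lattice A\<^esub> G = F \<inter> G"
    and "\<bottom>\<^bsub>principal_filter_lattice A\<^esub> = {\<top>}"
    and "\<top>\<^bsub>principal_filter_lattice A\<^esub> = carrier A"
proof -
  have *: "rl_filter A F" if "F \<in> S" for F
    using that filter_generated unfolding S_def by auto
  then show "S \<subseteq> {F. rl_filter A F}" by blast
  have "generated_filter A {\<top>} = {\<top>}"
    using generated_superset[of "{\<top>}"] generated_minimal[OF _ filter_top_set, of "{\<top>}"] by auto
  then have bot: "{\<top>} \<in> S" unfolding S_def by blast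
  have "generated_filter A {\<bottom>} = carrier A"
  proof -
    have b: "rl_filter A (generated_filter A {\<bottom>})" "\<bottom> \<in> generated_filter A {\<bottom>}"
      using filter_generated[of "{\<bottom>}"] generated_superset[of "{\<bottom>}"] by auto
    then show ?thesis using filter_up[OF b] filter_carrier[OF b(1)] by auto
  qed
  then have top: "carrier A \<in> S" unfolding S_def by blast
  have Int: "F \<inter> G \<in> S" if FG: "F \<in> S" "G \<in> S" for F G
  proof -
    obtain x y where xy: "x \<in> carrier A" "y \<in> carrier A"
      "F = generated_filter A {x}" "G = generated_filter A {y}"
      using FG by (auto simp: S_def)
    then have "F \<inter> G = generated_filter A {x \<squnion> y}" using principal_Int by simp
    then show ?thesis using xy join_closed[of x y] by (auto simp: S_def)
  qed
  have Un: "generated_filter A (F \<union> G) \<in> S" if FG: "F \<in> S" "G \<in> S" for F G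
  proof -
    obtain x y where xy: "x \<in> carrier A" "y \<in> carrier A"
      "F = generated_filter A {x}" "G = generated_filter A {y}"
      using FG by (auto simp: S_def)
    then have "generated_filter A (F \<union> G) = generated_filter A {x \<odot> y}"
      using principal_Un by simp
    then show ?thesis using xy rmult_closed[of x y] by (auto simp: S_def)
  qed
  have L: "principal_filter_lattice A = \<lparr>carrier = S, eq = (=), le = (\<subseteq>)\<rparr>"
    by (simp add: principal_filter_lattice_def S_def)
  note family = filter_family_lattice[of S, OF * bot top Int Un, folded L]
  show "bounded_distributive_lattice (principal_filter_lattice A)" by (rule family(1))
  show "F \<squnion>\<^bsub>principal_filter_lattice A\<^esub> G = generated_filter A (F \<union> G)"
    if "F \<in> S" "G \<in> S" for F G using family(2) that by simp
  show "F \<sqinter>\<^bsub>principal_filter_lattice A\<^esub> G = F \<inter> G"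
    if "F \<in> S" "G \<in> S" for F G using family(3) that by simp
  show "\<bottom>\<^bsub>principal_filter_lattice A\<^esub> = {\<top>}" by (rule family(4))
  show "\<top>\<^bsub>principal_filter_lattice A\<^esub> = carrier A" by (rule family(5))
qed

end

end

theory Submission
  imports Defs
begin

text \<open>
  Everything is reduced to one condition on elements. Two filters \<open>X\<close> and \<open>Y\<close> join to the whole
  algebra iff some element of \<open>X\<close> multiplies with some element of \<open>Y\<close> to \<open>\<bottom>\<close>, that is, iff \<open>X\<close> meets
  the set \<open>annihilator Y\<close> of all elements that some member of \<open>Y\<close> sends to \<open>\<bottom>\<close>. These sets are
  closed under joins, because multiplication distributes over joins. A pair of filters \<open>U\<close>, \<open>V\<close>
  that witnesses normality for \<open>X\<close>, \<open>Y\<close> can be shrunk to a pair of principal filters, generated by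
  \<open>u \<in> annihilator X\<close> and \<open>v \<in> annihilator Y\<close>, and \<open>U \<inter> V = {\<top>}\<close> becomes \<open>u \<squnion> v = \<top>\<close>. So
  normality says the same in both lattices: filters that join to the whole algebra have
  annihilators containing elements \<open>u\<close>, \<open>v\<close> with \<open>u \<squnion> v = \<top>\<close> (\<open>normal_iff_separated\<close>).
  Passing between arbitrary and principal \<open>X\<close>, \<open>Y\<close> is then immediate, since \<open>x \<odot> y = \<bottom>\<close> involves
  only one element from each filter (\<open>separation_principal\<close>).

  Separation implies the Gelfand property: if a prime filter \<open>P\<close> lies in distinct maximal filters
  \<open>M\<close>, \<open>N\<close>, then these join to the whole algebra, and \<open>u \<squnion> v = \<top> \<in> P\<close> puts \<open>u\<close> or \<open>v\<close> into \<open>P\<close>,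
  hence into \<open>M\<close> or \<open>N\<close>, although it is annihilated by an element there. Conversely, if \<open>\<top>\<close> is not
  among the joins \<open>u \<squnion> v\<close>, then a filter maximal among those avoiding all these joins is prime, and
  it can be enlarged by \<open>X\<close> to a proper filter and by \<open>Y\<close> to another. Maximal filters above the two
  enlargements are distinct, against the Gelfand property (\<open>gelfand_iff_separated\<close>).
\<close>

context residuated_lattice
begin

section \<open>Comaximal filters and annihilators\<close>

definition annihilator :: "'a set \<Rightarrow> 'a set" where
  "annihilator X = {u \<in> carrier A. \<exists>f \<in> X. u \<odot> f = \<bottom>}"

definition separated :: "'a set \<Rightarrow> 'a set \<Rightarrow> bool" where
  "separated X Y \<longleftrightarrow> (\<exists>u \<in> annihilator X. \<exists>v \<in> annihilator Y. u \<squnion> v = \<top>)"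

lemma annihilator_mono: "X \<subseteq> Y \<Longrightarrow> annihilator X \<subseteq> annihilator Y"
  unfolding annihilator_def by blast

lemma separated_mono: "separated X Y \<Longrightarrow> X \<subseteq> X' \<Longrightarrow> Y \<subseteq> Y' \<Longrightarrow> separated X' Y'"
  unfolding separated_def using annihilator_mono by blast

lemma bottom_rmult: "f \<in> carrier A \<Longrightarrow> \<bottom> \<odot> f = \<bottom>"
  using rmult_le_left[of \<bottom> f] rmult_closed by (simp add: le_antisym)

lemma bottom_annihilator: "rl_filter A X \<Longrightarrow> \<bottom> \<in> annihilator X"
  unfolding annihilator_def using filter_top[of X] bottom_rmult by auto

text \<open>If \<open>f\<close> annihilates \<open>u\<close> and \<open>g\<close> annihilates \<open>v\<close>, then \<open>f \<odot> g\<close> annihilates both.\<close>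

lemma annihilator_join:
  assumes X: "rl_filter A X" and "u \<in> annihilator X" "v \<in> annihilator X"
  shows "u \<squnion> v \<in> annihilator X"
proof -
  obtain f g where *: "f \<in> X" "g \<in> X" "u \<odot> f = \<bottom>" "v \<odot> g = \<bottom>"
    "u \<in> carrier A" "v \<in> carrier A"
    using assms unfolding annihilator_def by blast
  note c = filter_carrier[OF X *(1)] filter_carrier[OF X *(2)] *(5,6)
  have "u \<odot> (f \<odot> g) = (u \<odot> f) \<odot> g" "v \<odot> (f \<odot> g) = (v \<odot> g) \<odot> f"
    using c by (metis rmult_assoc rmult_comm)+
  then have "u \<odot> (f \<odot> g) = \<bottom>" "v \<odot> (f \<odot> g) = \<bottom>"
    using * c bottom_rmult by simp_all
  then have "(u \<squnion> v) \<odot> (f \<odot> g) \<sqsubseteq> \<bottom>"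
    using c rmult_closed by (intro rmult_join_le) simp_all
  then have "(u \<squnion> v) \<odot> (f \<odot> g) = \<bottom>"
    using c rmult_closed by (simp add: le_antisym)
  then show ?thesis
    unfolding annihilator_def using c filter_rmult[OF X *(1,2)] by auto
qed

lemma filter_eq_carrier_iff: "rl_filter A F \<Longrightarrow> F = carrier A \<longleftrightarrow> \<bottom> \<in> F"
  by (metis bottom_closed bottom_lower filter_carrier filter_up subsetI subset_antisym)

lemma comaximal_iff:
  assumes F: "rl_filter A F" and G: "rl_filter A G"
  shows "generated_filter A (F \<union> G) = carrier A \<longleftrightarrow> F \<inter> annihilator G \<noteq> {}"
proof -
  have "rl_filter A (generated_filter A (F \<union> G))"
    using F G by (intro filter_generated) (auto simp: rl_filter_def)
  then have "generated_filter A (F \<union> G) = carrier A \<longleftrightarrow> (\<exists>f \<in> F. \<exists>g \<in> G. f \<odot> g \<sqsubseteq> \<bottom>)"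
    using filter_eq_carrier_iff generated_Un[OF F G] by simp
  also have "\<dots> \<longleftrightarrow> (\<exists>f \<in> F. \<exists>g \<in> G. f \<odot> g = \<bottom>)"
    using filter_carrier[OF F] filter_carrier[OF G] rmult_closed
    by (metis bottom_closed bottom_lower le_antisym)
  also have "\<dots> \<longleftrightarrow> F \<inter> annihilator G \<noteq> {}"
    unfolding annihilator_def using filter_carrier[OF F] by blast
  finally show ?thesis .
qed

section \<open>Normality as separation\<close>

text \<open>
  The lattice of all filters and that of the principal ones are treated together: all that matters
  is that the lattice operations are the usual ones and that every principal filter is present,
  so that the two principal filters generated by separating elements can serve as witnesses.
\<close>

lemma normal_iff_separated:
  fixes L :: "'a set gorder"
  assumes L: "bounded_distributive_lattice L"
    and filters: "\<And>F. F \<in> carrier L \<Longrightarrow> rl_filter A F"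
    and principal: "\<And>x. x \<in> carrier A \<Longrightarrow> generated_filter A {x} \<in> carrier L"
    and join: "\<And>F G. F \<in> carrier L \<Longrightarrow> G \<in> carrier L
      \<Longrightarrow> F \<squnion>\<^bsub>L\<^esub> G = generated_filter A (F \<union> G)"
    and meet: "\<And>F G. F \<in> carrier L \<Longrightarrow> G \<in> carrier L \<Longrightarrow> F \<sqinter>\<^bsub>L\<^esub> G = F \<inter> G"
    and bot: "\<bottom>\<^bsub>L\<^esub> = {\<top>}" and top: "\<top>\<^bsub>L\<^esub> = carrier A"
  shows "normal_lattice L \<longleftrightarrow>
    (\<forall>X \<in> carrier L. \<forall>Y \<in> carrier L.
      generated_filter A (X \<union> Y) = carrier A \<longrightarrow> separated X Y)"
proof -
  have "(\<exists>U \<in> carrier L. \<exists>V \<in> carrier L.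
      U \<squnion>\<^bsub>L\<^esub> X = \<top>\<^bsub>L\<^esub> \<and> V \<squnion>\<^bsub>L\<^esub> Y = \<top>\<^bsub>L\<^esub> \<and> U \<sqinter>\<^bsub>L\<^esub> V = \<bottom>\<^bsub>L\<^esub>) \<longleftrightarrow> separated X Y"
    if XY: "X \<in> carrier L" "Y \<in> carrier L" for X Y
  proof
    assume "\<exists>U \<in> carrier L. \<exists>V \<in> carrier L.
      U \<squnion>\<^bsub>L\<^esub> X = \<top>\<^bsub>L\<^esub> \<and> V \<squnion>\<^bsub>L\<^esub> Y = \<top>\<^bsub>L\<^esub> \<and> U \<sqinter>\<^bsub>L\<^esub> V = \<bottom>\<^bsub>L\<^esub>"
    then obtain U V where UV: "U \<in> carrier L" "V \<in> carrier L" "U \<inter> V = {\<top>}"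
      "generated_filter A (U \<union> X) = carrier A" "generated_filter A (V \<union> Y) = carrier A"
      using XY join meet bot top by auto
    then obtain u v where uv: "u \<in> U" "u \<in> annihilator X" "v \<in> V" "v \<in> annihilator Y"
      using XY comaximal_iff filters by (metis disjoint_iff)
    then have c: "u \<in> carrier A" "v \<in> carrier A" by (auto simp: annihilator_def)
    have "u \<squnion> v \<in> U"
      using filter_join[OF filters[OF UV(1)] uv(1) c(2)] .
    moreover have "v \<squnion> u \<in> V"
      using filter_join[OF filters[OF UV(2)] uv(3) c(1)] .
    ultimately have "u \<squnion> v = \<top>"
      using UV(3) join_comm[of A u v] by auto
    then show "separated X Y"
      unfolding separated_def using uv by blast
  next
    assume "separated X Y"
    then obtain u v where uv: "u \<in> annihilator X" "v \<in> annihilator Y" "u \<squnion> v = \<top>"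
      unfolding separated_def by blast
    then have c: "u \<in> carrier A" "v \<in> carrier A" by (auto simp: annihilator_def)
    let ?U = "generated_filter A {u}" and ?V = "generated_filter A {v}"
    have "u \<in> ?U" "v \<in> ?V" using generated_superset by blast+
    then have "generated_filter A (?U \<union> X) = carrier A" "generated_filter A (?V \<union> Y) = carrier A"
      using comaximal_iff[of ?U X] comaximal_iff[of ?V Y] uv filters principal c XY by blast+
    moreover have "?U \<inter> ?V = {\<top>}"
    proof -
      have "?U \<inter> ?V = generated_filter A {\<top>}"
        using principal_Int[OF c] uv by simp
      then show ?thesis
        using generated_superset[of "{\<top>}"] generated_minimal[OF _ filter_top_set, of "{\<top>}"] by auto
    qed
    ultimately show "\<exists>U \<in> carrier L. \<exists>V \<in> carrier L.
      U \<squnion>\<^bsub>L\<^esub> X = \<top>\<^bsub>L\<^esub> \<and> V \<squnion>\<^bsub>L\<^esub> Y = \<top>\<^bsub>L\<^esub> \<and> U \<sqinter>\<^bsub>L\<^esub> V = \<bottom>\<^bsub>L\<^esub>"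
      using principal[OF c(1)] principal[OF c(2)] XY join meet bot top
      by (intro bexI[of _ ?U] bexI[of _ ?V]) auto
  qed
  then show ?thesis
    unfolding normal_lattice_def normal_lattice_axioms_def using L join top
    by (metis (no_types, lifting))
qed

lemma separation_principal:
  "(\<forall>X Y. rl_filter A X \<longrightarrow> rl_filter A Y \<longrightarrow>
      generated_filter A (X \<union> Y) = carrier A \<longrightarrow> separated X Y) \<longleftrightarrow>
    (\<forall>x \<in> carrier A. \<forall>y \<in> carrier A.
      generated_filter A (generated_filter A {x} \<union> generated_filter A {y}) = carrier A \<longrightarrow>
        separated (generated_filter A {x}) (generated_filter A {y}))"
    (is "?all \<longleftrightarrow> ?principal")
proof
  show "?all \<Longrightarrow> ?principal" using filter_generated by simp
next
  assume principal: ?principal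
  show ?all
  proof (intro allI impI)
    fix X Y assume XY: "rl_filter A X" "rl_filter A Y" "generated_filter A (X \<union> Y) = carrier A"
    then obtain x y where xy: "x \<in> X" "y \<in> Y" "x \<odot> y = \<bottom>"
      using comaximal_iff unfolding annihilator_def by blast
    have c: "x \<in> carrier A" "y \<in> carrier A"
      using xy XY filter_carrier by blast+
    have "\<bottom> \<in> generated_filter A {x \<odot> y}"
      using generated_superset[of "{x \<odot> y}"] xy by simp
    then have "generated_filter A (generated_filter A {x} \<union> generated_filter A {y}) = carrier A"
      using principal_Un[OF c] filter_eq_carrier_iff filter_generated[of "{x \<odot> y}"] rmult_closed c
      by simp
    then have "separated (generated_filter A {x}) (generated_filter A {y})"
      using principal c by blast
    then show "separated X Y"
      by (rule separated_mono) (use xy XY generated_minimal in simp_all)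
  qed
qed

lemma normal_filter_lattice_iff:
  "normal_lattice (filter_lattice A) \<longleftrightarrow>
    (\<forall>X Y. rl_filter A X \<longrightarrow> rl_filter A Y \<longrightarrow>
      generated_filter A (X \<union> Y) = carrier A \<longrightarrow> separated X Y)"
proof -
  have c: "carrier (filter_lattice A) = {F. rl_filter A F}"
    by (simp add: filter_lattice_def)
  show ?thesis
    by (subst normal_iff_separated)
      (auto simp: c filter_lattice filter_generated)
qed

lemma normal_principal_filter_lattice_iff:
  "normal_lattice (principal_filter_lattice A) \<longleftrightarrow>
    (\<forall>x \<in> carrier A. \<forall>y \<in> carrier A.
      generated_filter A (generated_filter A {x} \<union> generated_filter A {y}) = carrier A \<longrightarrow>
        separated (generated_filter A {x}) (generated_filter A {y}))"
proof -
  have c: "carrier (principal_filter_lattice A) = {generated_filter A {x} | x. x \<in> carrier A}"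
    by (simp add: principal_filter_lattice_def)
  have "normal_lattice (principal_filter_lattice A) \<longleftrightarrow>
    (\<forall>X \<in> carrier (principal_filter_lattice A). \<forall>Y \<in> carrier (principal_filter_lattice A).
      generated_filter A (X \<union> Y) = carrier A \<longrightarrow> separated X Y)"
    using principal_filter_lattice unfolding c[symmetric]
    by (intro normal_iff_separated) (auto simp: c)
  then show ?thesis unfolding c by blast
qed

section \<open>Filters that are maximal among those avoiding a set\<close>

lemma filter_Union_chain:
  assumes "C \<noteq> {}" and filters: "\<And>F. F \<in> C \<Longrightarrow> rl_filter A F"
    and chain: "\<And>F G. F \<in> C \<Longrightarrow> G \<in> C \<Longrightarrow> F \<subseteq> G \<or> G \<subseteq> F"
  shows "rl_filter A (\<Union>C)"
proof (rule filterI)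
  show "\<Union>C \<subseteq> carrier A" using filters filter_carrier by blast
  show "\<top> \<in> \<Union>C" using assms(1) filters filter_top by blast
next
  fix x y assume "x \<in> \<Union>C" "y \<in> \<Union>C"
  then obtain F G where "F \<in> C" "G \<in> C" "x \<in> F" "y \<in> G" by blast
  then show "x \<odot> y \<in> \<Union>C"
    using chain[of F G] filters filter_rmult by (metis UnionI subsetD)
next
  show "y \<in> \<Union>C" if "x \<in> \<Union>C" "x \<sqsubseteq> y" "y \<in> carrier A" for x y
    using that filters filter_up by blast
qed

lemma exists_filter_maximal_avoiding:
  assumes F: "rl_filter A F" "F \<inter> I = {}"
  obtains P where "rl_filter A P" "F \<subseteq> P" "P \<inter> I = {}"
    "\<forall>G. rl_filter A G \<longrightarrow> P \<subseteq> G \<longrightarrow> G \<inter> I = {} \<longrightarrow> G = P"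
proof -
  let ?S = "{G. rl_filter A G \<and> F \<subseteq> G \<and> G \<inter> I = {}}"
  have "\<Union>C \<in> ?S" if C: "C \<noteq> {}" "subset.chain ?S C" for C
  proof -
    have "rl_filter A (\<Union>C)"
      using C by (intro filter_Union_chain) (auto simp: subset_chain_def)
    then show ?thesis
      using C by (auto simp: subset_chain_def)
  qed
  then have "\<exists>P \<in> ?S. \<forall>G \<in> ?S. P \<subseteq> G \<longrightarrow> G = P"
    using F by (intro subset_Zorn_nonempty) auto
  then obtain P where "P \<in> ?S" "\<forall>G \<in> ?S. P \<subseteq> G \<longrightarrow> G = P" by blast
  then show thesis by (intro that[of P]) auto
qed

text \<open>
  For any element \<open>b\<close>, the elements \<open>a\<close> with \<open>a \<squnion> b \<in> P\<close> form a filter containing \<open>P\<close>.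
  If \<open>a \<squnion> b \<in> P\<close> with neither in \<open>P\<close>, this filter is strictly larger than \<open>P\<close>, so it contains some
  \<open>i \<in> I\<close>. Hence \<open>b \<squnion> i \<in> P\<close>, and the same argument replaces \<open>b\<close> by some \<open>j \<in> I\<close>. But then
  \<open>j \<squnion> i\<close> lies in both \<open>P\<close> and \<open>I\<close>.
\<close>

lemma maximal_avoiding_prime:
  assumes P: "rl_filter A P" "P \<inter> I = {}"
    and maximal: "\<forall>G. rl_filter A G \<longrightarrow> P \<subseteq> G \<longrightarrow> G \<inter> I = {} \<longrightarrow> G = P"
    and I: "I \<subseteq> carrier A" "I \<noteq> {}" "\<And>i j. i \<in> I \<Longrightarrow> j \<in> I \<Longrightarrow> i \<squnion> j \<in> I"
  shows "prime_filter A P"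
proof -
  have replace: "\<exists>i \<in> I. i \<squnion> b \<in> P"
    if ab: "a \<in> carrier A" "b \<in> carrier A" "a \<squnion> b \<in> P" "a \<notin> P" for a b
  proof (rule ccontr)
    let ?G = "{c \<in> carrier A. c \<squnion> b \<in> P}"
    assume "\<not> (\<exists>i \<in> I. i \<squnion> b \<in> P)"
    then have "?G \<inter> I = {}" by blast
    moreover have "P \<subseteq> ?G"
      using P ab filter_join filter_carrier by blast
    ultimately have "?G = P"
      using maximal filter_join_right[OF P(1) ab(2)] by blast
    then show False using ab by blast
  qed
  have "a \<in> P \<or> b \<in> P" if ab: "a \<in> carrier A" "b \<in> carrier A" "a \<squnion> b \<in> P" for a b
  proof (rule ccontr)
    assume no: "\<not> (a \<in> P \<or> b \<in> P)"
    then obtain i where i: "i \<in> I" "i \<squnion> b \<in> P" using replace ab by blast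
    then have "b \<squnion> i \<in> P" using join_comm[of A b i] by simp
    then obtain j where "j \<in> I" "j \<squnion> i \<in> P" using replace[of b i] i ab I(1) no by blast
    then show False using i I(3) P by blast
  qed
  moreover have "P \<noteq> carrier A" using I P by blast
  ultimately show ?thesis
    unfolding prime_filter_def proper_filter_def using P by blast
qed

lemma exists_maximal_filter:
  assumes F: "rl_filter A F" "F \<noteq> carrier A"
  obtains M where "maximal_filter A M" "F \<subseteq> M"
proof -
  \<comment> \<open>A filter is proper iff it avoids \<open>{\<bottom>}\<close>.\<close>
  obtain M where M: "rl_filter A M" "F \<subseteq> M" "M \<inter> {\<bottom>} = {}"
    "\<forall>G. rl_filter A G \<longrightarrow> M \<subseteq> G \<longrightarrow> G \<inter> {\<bottom>} = {} \<longrightarrow> G = M"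
    using exists_filter_maximal_avoiding[OF F(1), of "{\<bottom>}"] F filter_eq_carrier_iff by blast
  then have "maximal_filter A M"
    unfolding maximal_filter_def proper_filter_def using filter_eq_carrier_iff by blast
  then show thesis using that M by blast
qed

section \<open>The Gelfand property as separation\<close>

lemma proper_disjoint_annihilator:
  assumes "rl_filter A M" "M \<noteq> carrier A"
  shows "M \<inter> annihilator M = {}"
proof -
  have "m \<odot> f \<noteq> \<bottom>" if "m \<in> M" "f \<in> M" for m f
    using filter_rmult[OF assms(1) that] filter_eq_carrier_iff[OF assms(1)] assms(2) by auto
  then show ?thesis unfolding annihilator_def by blast
qed

lemma distinct_maximal_comaximal:
  assumes M: "maximal_filter A M" and N: "maximal_filter A N" and "M \<noteq> N"
  shows "generated_filter A (M \<union> N) = carrier A"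
proof (rule ccontr)
  let ?J = "generated_filter A (M \<union> N)"
  assume "?J \<noteq> carrier A"
  moreover have "rl_filter A ?J"
    using M N by (intro filter_generated)
      (auto simp: maximal_filter_def proper_filter_def rl_filter_def)
  ultimately have "?J = M" "?J = N"
    using M N generated_superset[of "M \<union> N"] unfolding maximal_filter_def proper_filter_def by auto
  then show False using assms by simp
qed

lemma gelfand_iff_separated:
  "gelfand A \<longleftrightarrow> (\<forall>X Y. rl_filter A X \<longrightarrow> rl_filter A Y \<longrightarrow>
      generated_filter A (X \<union> Y) = carrier A \<longrightarrow> separated X Y)"
proof
  assume sep: "\<forall>X Y. rl_filter A X \<longrightarrow> rl_filter A Y \<longrightarrow>
      generated_filter A (X \<union> Y) = carrier A \<longrightarrow> separated X Y"
  have "M = N" if P: "prime_filter A P" and M: "maximal_filter A M" "P \<subseteq> M"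
    and N: "maximal_filter A N" "P \<subseteq> N" for P M N
  proof (rule ccontr)
    assume "M \<noteq> N"
    have MN: "rl_filter A M" "M \<noteq> carrier A" "rl_filter A N" "N \<noteq> carrier A"
      using M N by (auto simp: maximal_filter_def proper_filter_def)
    then have "separated M N"
      using sep distinct_maximal_comaximal[OF M(1) N(1) \<open>M \<noteq> N\<close>] by blast
    then obtain u v where uv: "u \<in> annihilator M" "v \<in> annihilator N" "u \<squnion> v = \<top>"
      unfolding separated_def by blast
    then have c: "u \<in> carrier A" "v \<in> carrier A" by (auto simp: annihilator_def)
    have "\<top> \<in> P" using P filter_top by (auto simp: prime_filter_def proper_filter_def)
    then have "u \<in> P \<or> v \<in> P" using P c uv by (auto simp: prime_filter_def)
    then show False
      using uv M(2) N(2) MN proper_disjoint_annihilator by blast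
  qed
  moreover have "\<exists>M. maximal_filter A M \<and> P \<subseteq> M" if "prime_filter A P" for P
  proof -
    have "rl_filter A P" "P \<noteq> carrier A"
      using that by (simp_all add: prime_filter_def proper_filter_def)
    then obtain M where "maximal_filter A M" "P \<subseteq> M" by (rule exists_maximal_filter)
    then show ?thesis by blast
  qed
  ultimately show "gelfand A"
    unfolding gelfand_def by blast
next
  assume gelfand: "gelfand A"
  show "\<forall>X Y. rl_filter A X \<longrightarrow> rl_filter A Y \<longrightarrow>
      generated_filter A (X \<union> Y) = carrier A \<longrightarrow> separated X Y"
  proof (intro allI impI, rule ccontr)
    fix X Y assume X: "rl_filter A X" and Y: "rl_filter A Y"
      and XY: "generated_filter A (X \<union> Y) = carrier A" and not_separated: "\<not> separated X Y"
    let ?I = "{u \<squnion> v | u v. u \<in> annihilator X \<and> v \<in> annihilator Y}"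
    have ann: "u \<in> carrier A" if "u \<in> annihilator Z" for u Z
      using that by (simp add: annihilator_def)
    have I_carrier: "?I \<subseteq> carrier A" using ann by auto
    have I_annihilators: "annihilator X \<subseteq> ?I" "annihilator Y \<subseteq> ?I"
    proof -
      have bot: "u \<squnion> \<bottom> = u" "\<bottom> \<squnion> u = u" if "u \<in> carrier A" for u
        using that le_iff_meet[of \<bottom> u] join_comm[of A u \<bottom>] by simp_all
      show "annihilator X \<subseteq> ?I"
      proof
        fix u assume u: "u \<in> annihilator X"
        show "u \<in> ?I"
          using u bottom_annihilator[OF Y] bot(1)[OF ann[OF u], symmetric] by blast
      qed
      show "annihilator Y \<subseteq> ?I"
      proof
        fix v assume v: "v \<in> annihilator Y"
        show "v \<in> ?I"
          using v bottom_annihilator[OF X] bot(2)[OF ann[OF v], symmetric] by blast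
      qed
    qed
    have I_join: "i \<squnion> j \<in> ?I" if ij: "i \<in> ?I" "j \<in> ?I" for i j
    proof -
      obtain u v u' v' where *: "i = u \<squnion> v" "j = u' \<squnion> v'"
        "u \<in> annihilator X" "v \<in> annihilator Y" "u' \<in> annihilator X" "v' \<in> annihilator Y"
        using ij by blast
      note c = ann[OF *(3)] ann[OF *(4)] ann[OF *(5)] ann[OF *(6)]
      have "i \<squnion> j = (u \<squnion> u') \<squnion> (v \<squnion> v')"
        unfolding *(1,2) using c by (metis join_assoc join_closed join_comm)
      moreover have "u \<squnion> u' \<in> annihilator X" "v \<squnion> v' \<in> annihilator Y"
        using * annihilator_join X Y by simp_all
      ultimately show ?thesis by blast
    qed
    have "{\<top>} \<inter> ?I = {}" using not_separated unfolding separated_def by force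
    then obtain P where P: "rl_filter A P" "{\<top>} \<subseteq> P" "P \<inter> ?I = {}"
      "\<forall>G. rl_filter A G \<longrightarrow> P \<subseteq> G \<longrightarrow> G \<inter> ?I = {} \<longrightarrow> G = P"
      by (rule exists_filter_maximal_avoiding[OF filter_top_set])
    have "\<bottom> \<in> ?I" by (rule subsetD[OF I_annihilators(1) bottom_annihilator[OF X]])
    then have "?I \<noteq> {}" by (metis empty_iff)
    have "prime_filter A P"
      by (rule maximal_avoiding_prime[OF P(1,3,4) I_carrier \<open>?I \<noteq> {}\<close> I_join])
    have above: "\<exists>M. maximal_filter A M \<and> P \<subseteq> M \<and> Z \<subseteq> M"
      if Z: "rl_filter A Z" "annihilator Z \<subseteq> ?I" for Z
    proof -
      let ?J = "generated_filter A (P \<union> Z)"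
      have "?J \<noteq> carrier A" using comaximal_iff[OF P(1) Z(1)] Z P by blast
      moreover have "rl_filter A ?J"
        using P Z by (intro filter_generated) (auto simp: rl_filter_def)
      ultimately obtain M where "maximal_filter A M" "?J \<subseteq> M"
        using exists_maximal_filter by blast
      then show ?thesis using generated_superset[of "P \<union> Z"] by blast
    qed
    obtain M N where M: "maximal_filter A M" "P \<subseteq> M" "X \<subseteq> M"
      and N: "maximal_filter A N" "P \<subseteq> N" "Y \<subseteq> N"
      using above[OF X I_annihilators(1)] above[OF Y I_annihilators(2)] by blast
    then have "M = N"
      using gelfand \<open>prime_filter A P\<close> unfolding gelfand_def by blast
    then have "carrier A \<subseteq> M"
      using M N XY generated_minimal[of "X \<union> Y" M]
      by (auto simp: maximal_filter_def proper_filter_def)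
    then show False
      using M(1) by (auto simp: maximal_filter_def proper_filter_def rl_filter_def)
  qed
qed

end

theorem theorem3p4:
  fixes A :: "('a, 'b) reslat_scheme"
  assumes "residuated_lattice A"
  shows "(normal_lattice (filter_lattice A) \<longleftrightarrow> normal_lattice (principal_filter_lattice A)) \<and>
    (normal_lattice (principal_filter_lattice A) \<longleftrightarrow> gelfand A)"
proof -
  interpret residuated_lattice A by (rule assms)
  show ?thesis
    unfolding normal_filter_lattice_iff normal_principal_filter_lattice_iff
      gelfand_iff_separated separation_principal
    by simp
qed

end
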